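(* Let $D=(V,E)$ be a directed graph, let $s,t\in V$ be distinct vertices, and let $A$ and $B$ be $st$-embracing spanning trees of $D$. Then there exist $st$-embracing spanning trees $$A=T_0,T_1,\ldots,T_q=B$$ of $D$ with $q\leq |V|-1$ such that $|T_{i-1}\mathbin{\Delta}T_i|=2$ and $|T_i\cap B|\geq |T_{i-1}\cap B|$ for every $i\in\{1,\dots,q\}$.
   Context: Directed graphs are finite. A spanning tree of $D$ means a spanning tree of its underlying undirected graph, identified with its set of arcs. For a spanning tree $T$ and $u,v\in V$, $T[u,v]$ denotes the unique path in $T$ from $u$ to $v$, traversed from $u$ to $v$ (its arcs need not all be oriented in the direction of traversal). $T$ is called $uv$-embracing if $T[u,v]$ is a directed path from $u$ to $v$, i.e. all its arcs are oriented in the direction of the traversal. *)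

theory Defs
  imports "Graph_Theory.Digraph_Component"
begin

text \<open>
  The library predicates \<open>forest\<close>, \<open>tree\<close> and \<open>spanning_tree\<close> exclude only directed cycles, so
  they do not describe forests and trees of the underlying undirected graph. The notions needed
  here are obtained from the underlying undirected multigraph, encoded as follows: every arc \<open>e\<close>
  can be traversed forwards, as \<open>(e, True)\<close>, or backwards, as \<open>(e, False)\<close>. The arc walks and paths
  (\<open>awalk\<close>, \<open>apath\<close>) of this digraph are the undirected walks and paths, with the
  direction of traversal of every arc recorded.
\<close>

definition traversals :: "('a,'b) pre_digraph \<Rightarrow> ('a, 'b \<times> bool) pre_digraph" where
  "traversals G =
     \<lparr> verts = verts G,
       arcs = arcs G \<times> UNIV,
       tail = (\<lambda>(e, fwd). if fwd then tail G e else head G e),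
       head = (\<lambda>(e, fwd). if fwd then head G e else tail G e) \<rparr>"

text \<open>
  Distinctness of the underlying arcs rules out traversing one arc forth and back. Loops and pairs
  of (anti)parallel arcs do form undirected cycles.
\<close>

definition undirected_cycle :: "('a,'b) pre_digraph \<Rightarrow> ('b \<times> bool) list \<Rightarrow> bool" where
  "undirected_cycle G p \<longleftrightarrow> pre_digraph.cycle (traversals G) p \<and> distinct (map fst p)"

definition undirected_tree :: "('a,'b) pre_digraph \<Rightarrow> bool" where
  "undirected_tree G \<longleftrightarrow> connected G \<and> \<not> (\<exists>p. undirected_cycle G p)"

definition span_subgraph :: "('a,'b) pre_digraph \<Rightarrow> 'b set \<Rightarrow> ('a,'b) pre_digraph" where
  "span_subgraph G T = G\<lparr>arcs := T\<rparr>"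

definition undirected_spanning_tree :: "('a,'b) pre_digraph \<Rightarrow> 'b set \<Rightarrow> bool" where
  "undirected_spanning_tree G T \<longleftrightarrow> T \<subseteq> arcs G \<and> undirected_tree (span_subgraph G T)"

definition tree_path :: "('a,'b) pre_digraph \<Rightarrow> 'b set \<Rightarrow> 'a \<Rightarrow> 'a \<Rightarrow> ('b \<times> bool) list" where
  "tree_path G T u v = (THE p. pre_digraph.apath (traversals (span_subgraph G T)) u p v)"

definition embracing_spanning_tree :: "('a,'b) pre_digraph \<Rightarrow> 'a \<Rightarrow> 'a \<Rightarrow> 'b set \<Rightarrow> bool" where
  "embracing_spanning_tree G u v T \<longleftrightarrow>
     undirected_spanning_tree G T \<and> (\<forall>(e, fwd) \<in> set (tree_path G T u v). fwd)"

end

theory Submission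
  imports Defs
begin

text \<open>
  Root every spanning tree at \<open>t\<close>. A spanning tree is then the same thing as a choice, for every
  vertex \<open>v \<noteq> t\<close>, of a traversal of an arc from \<open>v\<close> to another vertex, its parent, such that
  following parents always terminates in \<open>t\<close> (\<open>undirected_spanning_tree_parent_arcs\<close>,
  \<open>spanning_tree_rooted\<close>). The tree path from \<open>s\<close> to \<open>t\<close> follows parents, so the tree is
  \<open>st\<close>-embracing iff the parent traversals met on the way up from \<open>s\<close> are all forward
  (\<open>embracing_iff_directed_ascent\<close>).

  Let \<open>W\<close> be a set of vertices that contains \<open>t\<close> and is closed under taking parents in \<open>B\<close>. Giving
  the vertices in \<open>W\<close> their parents in \<open>B\<close>, and all others their parents in \<open>A\<close>, yields a
  spanning tree again: from any vertex one climbs in \<open>A\<close> until \<open>W\<close> is entered, and in \<open>B\<close> from then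
  on. This tree is \<open>A\<close> for \<open>W = {t}\<close> and \<open>B\<close> for \<open>W = V\<close>. Let \<open>Q\<close> be the vertex set of the path
  from \<open>s\<close> to \<open>t\<close> in \<open>B\<close>. If \<open>W \<subseteq> Q\<close>, then the climb from \<open>s\<close> uses first the directed path of
  \<open>A\<close> and then a final part of the directed path of \<open>B\<close>; if \<open>Q \<subseteq> W\<close>, then it is the directed path
  of \<open>B\<close>. In both cases the tree is \<open>st\<close>-embracing (\<open>mixed_embracing\<close>).

  It remains to let \<open>W\<close> grow from \<open>{t}\<close> to \<open>V\<close> by one vertex at a time, taking the vertices of \<open>Q\<close>
  first. There are \<open>\<bar>V\<bar> - 1\<close> such steps. Each either leaves the tree unchanged, and is skipped, or
  replaces a single arc by an arc of \<open>B\<close>, which cannot decrease the intersection with \<open>B\<close>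
  (\<open>mixed_exchange\<close>).
\<close>

section \<open>Undirected walks and connectivity\<close>

lemma traversals_simps [simp]:
  "verts (traversals G) = verts G"
  "a \<in> arcs (traversals G) \<longleftrightarrow> fst a \<in> arcs G"
  "verts (span_subgraph G T) = verts G"
  "arcs (span_subgraph G T) = T"
  "tail (traversals (span_subgraph G T)) = tail (traversals G)"
  "head (traversals (span_subgraph G T)) = head (traversals G)"
  by (auto simp: traversals_def span_subgraph_def mem_Times_iff)

definition reverse_traversal :: "'b \<times> bool \<Rightarrow> 'b \<times> bool" where
  "reverse_traversal a = (fst a, \<not> snd a)"

lemma reverse_traversal_simps [simp]:
  "fst (reverse_traversal a) = fst a"
  "tail (traversals G) (reverse_traversal a) = head (traversals G) a"
  "head (traversals G) (reverse_traversal a) = tail (traversals G) a"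
  by (auto simp: reverse_traversal_def traversals_def split: prod.splits)

lemma traversal_eq_or_reverse:
  "fst a = fst b \<Longrightarrow> a = b \<or> a = reverse_traversal b"
  by (auto simp: reverse_traversal_def prod_eq_iff)

lemma wf_digraph_traversals:
  assumes "wf_digraph D" "T \<subseteq> arcs D"
  shows "wf_digraph (traversals (span_subgraph D T))"
proof -
  interpret wf_digraph D by fact
  show ?thesis using assms(2)
    by unfold_locales (auto simp: traversals_def span_subgraph_def)
qed

text \<open>
  The arcs of the symmetric closure \<open>mk_symmetric G\<close> are exactly the ordered pairs of ends of
  traversals, so the two digraphs have the same reachability relation. By symmetry, reaching one
  common vertex from everywhere is enough for connectivity.
\<close>

lemma
  assumes "wf_digraph (traversals G)"
  shows connected_apath: "connected G \<Longrightarrow> u \<in> verts G \<Longrightarrow> v \<in> verts G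
      \<Longrightarrow> \<exists>p. pre_digraph.apath (traversals G) u p v"
    and connected_if_walks_to: "t \<in> verts G
      \<Longrightarrow> (\<And>v. v \<in> verts G \<Longrightarrow> \<exists>p. pre_digraph.awalk (traversals G) v p t) \<Longrightarrow> connected G"
proof -
  interpret N: wf_digraph "traversals G" by fact
  have ends: "arcs_ends (traversals G) = parcs (mk_symmetric G)"
  proof -
    have "arcs_ends (traversals G)
      = (\<lambda>(e, fwd). if fwd then (tail G e, head G e) else (head G e, tail G e)) ` (arcs G \<times> UNIV)"
      unfolding arcs_ends_conv by (intro image_cong) (auto simp: traversals_def)
    also have "\<dots> = parcs (mk_symmetric G)"
      by (auto simp: parcs_mk_symmetric image_def split: if_splits)
    finally show ?thesis .
  qed
  have reach: "u \<rightarrow>\<^sup>*\<^bsub>with_proj (mk_symmetric G)\<^esub> v \<longleftrightarrow> u \<rightarrow>\<^sup>*\<^bsub>traversals G\<^esub> v" for u v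
    by (simp add: reachable_def ends)
  have "symmetric (traversals G)"
    using symmetric_mk_symmetric[of G] by (simp add: symmetric_def ends)
  then have sym: "u \<rightarrow>\<^sup>*\<^bsub>traversals G\<^esub> v \<Longrightarrow> v \<rightarrow>\<^sup>*\<^bsub>traversals G\<^esub> u" for u v
    by (rule symmetric_reachable)
  show "\<exists>p. N.apath u p v" if "connected G" "u \<in> verts G" "v \<in> verts G"
    using that by (auto simp: connected_def strongly_connected_def reach N.reachable_apath)
  assume t: "t \<in> verts G" and "\<And>v. v \<in> verts G \<Longrightarrow> \<exists>p. N.awalk v p t"
  then have "v \<rightarrow>\<^sup>*\<^bsub>traversals G\<^esub> t" if "v \<in> verts G" for v
    using that by (simp add: N.reachable_awalk)
  then have "u \<rightarrow>\<^sup>*\<^bsub>traversals G\<^esub> v" if "u \<in> verts G" "v \<in> verts G" for u v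
    using that sym N.reachable_trans by blast
  with t show "connected G"
    by (auto simp: connected_def strongly_connected_def reach)
qed

text \<open>
  A path cannot use one arc in both directions either: every traversal of an arc visits both of its
  ends, and a path visits the tail of its first traversal only once.
\<close>

lemma apath_distinct_arcs:
  assumes "wf_digraph (traversals G)" "pre_digraph.apath (traversals G) u p v"
  shows "distinct (map fst p)"
proof -
  interpret N: wf_digraph "traversals G" by fact
  show ?thesis using assms(2)
  proof (induction p arbitrary: u)
    case (Cons a p)
    let ?c = "head (traversals G) a"
    from Cons.prems have p: "N.apath ?c p v" and u: "tail (traversals G) a \<notin> set (N.awalk_verts ?c p)"
      by (auto simp: N.apath_Cons_iff)
    have "fst a \<noteq> fst b" if b: "b \<in> set p" for b
    proof
      assume "fst a = fst b"
      then have "tail (traversals G) a \<in> {tail (traversals G) b, head (traversals G) b}"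
        using traversal_eq_or_reverse[of a b] by auto
      moreover have "set (N.awalk_verts ?c p)
          = {?c} \<union> set (map (tail (traversals G)) p) \<union> set (map (head (traversals G)) p)"
        using p by (intro N.set_awalk_verts) (auto simp: N.apath_def)
      ultimately show False using b u by auto
    qed
    then show ?case using Cons.IH[OF p] by auto
  qed simp
qed

section \<open>Trees given by parents\<close>

definition parent_arcs :: "('a,'b) pre_digraph \<Rightarrow> 'a \<Rightarrow> ('a \<Rightarrow> 'b \<times> bool) \<Rightarrow> 'b set" where
  "parent_arcs D t parent = (\<lambda>v. fst (parent v)) ` (verts D - {t})"

text \<open>
  A set on which the climb towards the root never leaves the set and only uses arcs in their own
  direction. It replaces the directed path from a vertex to \<open>t\<close>, and is easier to combine
  from pieces of different trees than a list of arcs.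
\<close>

definition directed_ascent ::
    "('a,'b) pre_digraph \<Rightarrow> 'a \<Rightarrow> ('a \<Rightarrow> 'b \<times> bool) \<Rightarrow> 'a set \<Rightarrow> bool" where
  "directed_ascent D t parent S \<longleftrightarrow> t \<in> S \<and> S \<subseteq> verts D
     \<and> (\<forall>v\<in>S - {t}. snd (parent v) \<and> head (traversals D) (parent v) \<in> S)"

text \<open>
  The function \<open>depth\<close> serves only to make the climb to the root terminate; it need not be the
  distance to the root. This freedom lets two trees with unrelated depths be combined.
\<close>

locale rooted_tree = wf_digraph D for D :: "('a,'b) pre_digraph" +
  fixes t :: 'a and parent :: "'a \<Rightarrow> 'b \<times> bool" and depth :: "'a \<Rightarrow> nat"
  assumes root: "t \<in> verts D"
    and parent_arc: "v \<in> verts D - {t} \<Longrightarrow> fst (parent v) \<in> arcs D"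
    and parent_tail: "v \<in> verts D - {t} \<Longrightarrow> tail (traversals D) (parent v) = v"
    and parent_depth: "v \<in> verts D - {t} \<Longrightarrow> depth (head (traversals D) (parent v)) < depth v"
begin

abbreviation tree_arcs :: "'b set" where
  "tree_arcs \<equiv> parent_arcs D t parent"

abbreviation up :: "'a \<Rightarrow> 'a" where
  "up v \<equiv> head (traversals D) (parent v)"

abbreviation walks :: "('a, 'b \<times> bool) pre_digraph" where
  "walks \<equiv> traversals (span_subgraph D tree_arcs)"

lemma parent_in_tree_arcs: "v \<in> verts D - {t} \<Longrightarrow> fst (parent v) \<in> tree_arcs"
  by (auto simp: parent_arcs_def)

lemma tree_arcs_subset: "tree_arcs \<subseteq> arcs D"
  using parent_arc by (auto simp: parent_arcs_def)

lemma wf_walks: "wf_digraph walks"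
  by (rule wf_digraph_traversals[OF wf_digraph_axioms tree_arcs_subset])

interpretation N: wf_digraph walks by (rule wf_walks)

lemma up_in_verts: "v \<in> verts D - {t} \<Longrightarrow> up v \<in> verts D"
  using parent_arc[of v] head_in_verts tail_in_verts
  by (auto simp: traversals_def split: prod.splits)

text \<open>
  Every traversal of a tree arc leads from a vertex to its parent or back, and so strictly changes
  the depth.
\<close>

lemma traversal_cases:
  assumes "fst a \<in> tree_arcs"
  obtains (up) "tail (traversals D) a \<in> verts D - {t}" "a = parent (tail (traversals D) a)"
        | (down) "head (traversals D) a \<in> verts D - {t}"
            "a = reverse_traversal (parent (head (traversals D) a))"
proof -
  from assms obtain v where v: "v \<in> verts D - {t}" "fst a = fst (parent v)"
    by (auto simp: parent_arcs_def)
  from traversal_eq_or_reverse[OF v(2)] show thesis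
    using v(1) parent_tail[OF v(1)] that by auto
qed

lemma no_tree_loops:
  assumes "fst a \<in> tree_arcs" shows "tail (traversals D) a \<noteq> head (traversals D) a"
  using assms
proof (cases rule: traversal_cases)
  case up
  then show ?thesis using parent_depth[OF up(1)] by (metis less_irrefl)
next
  case down
  then have "tail (traversals D) a = up (head (traversals D) a)"
    by (metis reverse_traversal_simps(2))
  then show ?thesis using parent_depth[OF down(1)] by auto
qed

text \<open>
  Two vertices sharing their parent arc would be each other's parent, and each would be deeper than
  the other.
\<close>

lemma parent_inj:
  assumes "u \<in> verts D - {t}" "v \<in> verts D - {t}" "fst (parent u) = fst (parent v)"
  shows "u = v"
  using traversal_eq_or_reverse[OF assms(3)]
proof
  assume "parent u = parent v"
  then show ?thesis using assms(1,2) parent_tail by metis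
next
  assume r: "parent u = reverse_traversal (parent v)"
  have "up u = v" "up v = u"
    using r parent_tail[OF assms(1)] parent_tail[OF assms(2)] by auto
  then have False
    using parent_depth[OF assms(1)] parent_depth[OF assms(2)] by auto
  then show ?thesis ..
qed

text \<open>
  A walk that has just descended to a vertex can climb only by going back over the parent arc of that
  vertex. Without repeated arcs, a walk that starts downwards therefore never climbs, and since every
  vertex to which it descends has a parent, it does not end in the root.
\<close>

lemma walk_leaving_downwards:
  assumes "N.awalk u p v" "distinct (map fst p)" "p \<noteq> []"
    and "u = t \<or> fst (hd p) \<noteq> fst (parent u)"
  shows "depth u < depth v \<and> v \<noteq> t"
  using assms
proof (induction p arbitrary: u)
  case (Cons a p)
  let ?c = "head (traversals D) a"
  from Cons.prems have a: "fst a \<in> tree_arcs" "tail (traversals D) a = u"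
    and p: "N.awalk ?c p v" "distinct (map fst p)"
    by (auto simp: N.awalk_Cons_iff)
  from a(1) have down: "?c \<in> verts D - {t}" "a = reverse_traversal (parent ?c)"
    by (cases rule: traversal_cases; use Cons.prems(4) a(2) in auto)+
  have "up ?c = u" using down(2) a(2) by (metis reverse_traversal_simps(2))
  then have less: "depth u < depth ?c" using parent_depth[OF down(1)] by simp
  show ?case
  proof (cases "p = []")
    case True
    then show ?thesis using p(1) less down(1) by (auto simp: N.awalk_Nil_iff)
  next
    case False
    have "fst a = fst (parent ?c)" using down(2) by (metis reverse_traversal_simps(1))
    then have "fst (hd p) \<noteq> fst (parent ?c)"
      using Cons.prems(2) False by (cases p) auto
    then show ?thesis using Cons.IH[OF p False] less by auto
  qed
qed simp

text \<open>
  The time-reversed counterpart: a walk without repeated arcs that arrives upwards has only climbed.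
\<close>

lemma walk_arriving_upwards:
  assumes "N.awalk u p v" "distinct (map fst p)" "p \<noteq> []"
    and "v = t \<or> fst (last p) \<noteq> fst (parent v)"
  shows "depth v < depth u"
  using assms
proof (induction p arbitrary: v rule: rev_induct)
  case (snoc a p)
  let ?c = "tail (traversals D) a"
  from snoc.prems have a: "fst a \<in> tree_arcs" "head (traversals D) a = v"
    and p: "N.awalk u p ?c" "distinct (map fst p)"
    by (auto simp: N.awalk_simps)
  from a(1) have up: "?c \<in> verts D - {t}" "a = parent ?c"
    by (cases rule: traversal_cases; use snoc.prems(4) a(2) in \<open>auto dest: arg_cong[of _ _ fst]\<close>)+
  have "up ?c = v" using up(2) a(2) by metis
  then have less: "depth v < depth ?c" using parent_depth[OF up(1)] by simp
  show ?case
  proof (cases "p = []")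
    case True
    then show ?thesis using p(1) less by (auto simp: N.awalk_Nil_iff)
  next
    case False
    have "fst (last p) \<noteq> fst (parent ?c)"
      using snoc.prems(2) False up(2) by (cases p rule: rev_cases) auto
    then show ?thesis using snoc.IH[OF p False] less by auto
  qed
qed simp

text \<open>
  A closed walk ends at the depth at which it starts, so it neither starts downwards nor arrives
  upwards. It starts and ends with the parent arc of its base point, which
  means that it consists of a single arc, a loop; and tree arcs are not loops.
\<close>

lemma no_undirected_cycle: "\<not> undirected_cycle (span_subgraph D tree_arcs) p"
proof
  assume "undirected_cycle (span_subgraph D tree_arcs) p"
  then obtain u where p: "N.awalk u p u" "distinct (map fst p)" "p \<noteq> []"
    by (auto simp: undirected_cycle_def N.cycle_def)
  have "fst (hd p) = fst (last p)"
    using walk_leaving_downwards[OF p] walk_arriving_upwards[OF p] by (metis less_irrefl)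
  then obtain a where "p = [a]"
    using p(2,3) by (cases p rule: rev_cases) (auto simp: hd_append split: if_splits)
  then show False
    using p(1) no_tree_loops[of a] by (auto simp: N.awalk_simps)
qed

lemma walk_to_root: "v \<in> verts D \<Longrightarrow> \<exists>p. N.awalk v p t"
proof (induction "depth v" arbitrary: v rule: less_induct)
  case less
  show ?case
  proof (cases "v = t")
    case True
    then show ?thesis using root by (auto simp: N.awalk_Nil_iff intro: exI[of _ "[]"])
  next
    case False
    with less.prems have v: "v \<in> verts D - {t}" by simp
    obtain p where "N.awalk (up v) p t"
      using less.hyps[OF parent_depth[OF v] up_in_verts[OF v]] by blast
    then have "N.awalk v (parent v # p) t"
      using parent_tail[OF v] parent_in_tree_arcs[OF v] by (simp add: N.awalk_Cons_iff)
    then show ?thesis by blast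
  qed
qed

lemma connected_parent_arcs: "connected (span_subgraph D tree_arcs)"
  by (rule connected_if_walks_to[OF wf_walks, of t]) (simp_all add: root walk_to_root)

lemma undirected_spanning_tree_parent_arcs: "undirected_spanning_tree D tree_arcs"
  using tree_arcs_subset connected_parent_arcs no_undirected_cycle
  by (auto simp: undirected_spanning_tree_def undirected_tree_def)

text \<open>
  A path to the root cannot start downwards, so its first step is forced. This gives uniqueness of the
  path and shows that it follows parents.
\<close>

lemma apath_to_root_step:
  assumes "N.apath u (a # p) t"
  shows "u \<in> verts D - {t}" "a = parent u" "N.apath (up u) p t"
proof -
  have w: "N.awalk u (a # p) t" and d: "distinct (map fst (a # p))"
    using assms apath_distinct_arcs[OF wf_walks assms] by (auto simp: N.apath_def)
  from walk_leaving_downwards[OF w d] have ut: "u \<noteq> t" "fst a = fst (parent u)" by auto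
  have tl: "tail (traversals D) a = u" "fst a \<in> tree_arcs" using w by (auto simp: N.awalk_Cons_iff)
  show u: "u \<in> verts D - {t}" using w ut(1) N.awalk_hd_in_verts by fastforce
  show a: "a = parent u"
    using traversal_eq_or_reverse[OF ut(2)] no_tree_loops[OF tl(2)] tl(1) parent_tail[OF u]
    by (metis reverse_traversal_simps(3))
  show "N.apath (up u) p t" using assms a by (simp add: N.apath_Cons_iff)
qed

lemma apath_to_root_unique:
  assumes "N.apath u p t" "N.apath u q t"
  shows "p = q"
  using assms
proof (induction p arbitrary: u q)
  case Nil
  then have "u = t" by (simp add: N.apath_Nil_iff)
  then show ?case using Nil.prems(2) apath_to_root_step(1)[of t] by (cases q) blast+
next
  case (Cons a p)
  show ?case
  proof (cases q)
    case Nil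
    then show ?thesis
      using Cons.prems(2) apath_to_root_step(1)[OF Cons.prems(1)] by (simp add: N.apath_Nil_iff)
  next
    case (Cons b q')
    then show ?thesis
      using Cons.IH Cons.prems apath_to_root_step(2,3) by metis
  qed
qed

text \<open>
  The definite description in \<open>tree_path\<close> is meaningful for paths to the root.
\<close>

lemma apath_tree_path:
  assumes "u \<in> verts D"
  shows "N.apath u (tree_path D tree_arcs u t) t"
proof -
  obtain p where p: "N.apath u p t"
    using walk_to_root[OF assms] N.apath_awalk_to_apath by blast
  then show ?thesis unfolding tree_path_def
    by (rule theI) (rule apath_to_root_unique[OF _ p])
qed

lemma directed_ascent_forward:
  assumes "N.apath u p t" "u \<in> S" "directed_ascent D t parent S"
  shows "\<forall>a\<in>set p. snd a"
  using assms(1,2)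
proof (induction p arbitrary: u)
  case (Cons a p)
  note step = apath_to_root_step[OF Cons.prems(1)]
  have "snd (parent u)" "up u \<in> S"
    using assms(3) Cons.prems(2) step(1) by (auto simp: directed_ascent_def)
  then show ?case using Cons.IH step(2,3) by auto
qed simp

text \<open>
  The witness is the set of vertices of the path.
\<close>

lemma forward_directed_ascent:
  assumes "N.apath u p t" "\<forall>a\<in>set p. snd a"
  shows "\<exists>S. u \<in> S \<and> directed_ascent D t parent S"
  using assms
proof (induction p arbitrary: u)
  case Nil
  then show ?case using root
    by (intro exI[of _ "{t}"]) (auto simp: N.apath_Nil_iff directed_ascent_def)
next
  case (Cons a p)
  note step = apath_to_root_step[OF Cons.prems(1)]
  obtain S where "up u \<in> S" "directed_ascent D t parent S"
    using Cons.IH[OF step(3)] Cons.prems(2) by auto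
  then show ?case using Cons.prems(2) step(1,2)
    by (intro exI[of _ "insert u S"]) (auto simp: directed_ascent_def)
qed

lemma embracing_iff_directed_ascent:
  assumes "s \<in> verts D"
  shows "embracing_spanning_tree D s t tree_arcs
    \<longleftrightarrow> (\<exists>S. s \<in> S \<and> directed_ascent D t parent S)"
  using directed_ascent_forward[OF apath_tree_path[OF assms]]
    forward_directed_ascent[OF apath_tree_path[OF assms]] undirected_spanning_tree_parent_arcs
  by (auto simp: embracing_spanning_tree_def split_beta)

end

section \<open>Every spanning tree is given by parents\<close>

text \<open>
  Take as depth the distance to \<open>t\<close> and as parent traversal the first arc of a shortest walk to
  \<open>t\<close>. The parent arcs form a connected spanning subgraph of the tree, so any further arc of the
  tree would close a cycle with a path of parent arcs.
\<close>

lemma spanning_tree_rooted: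
  assumes "wf_digraph D" "undirected_spanning_tree D T" "t \<in> verts D"
  obtains parent depth where "rooted_tree D t parent depth" "parent_arcs D t parent = T"
proof -
  let ?N = "traversals (span_subgraph D T)"
  have T: "T \<subseteq> arcs D" and conn: "connected (span_subgraph D T)"
    and acyclic: "\<And>p. \<not> undirected_cycle (span_subgraph D T) p"
    using assms(2) by (auto simp: undirected_spanning_tree_def undirected_tree_def)
  interpret D: wf_digraph D by fact
  interpret N: wf_digraph ?N by (rule wf_digraph_traversals[OF assms(1) T])
  have walk: "\<exists>p. N.awalk v p t" if "v \<in> verts D" for v
    using connected_apath[OF N.wf_digraph_axioms conn, of v t] assms(3) that
    by (auto simp: N.apath_def)
  define depth where "depth v = (LEAST n. \<exists>p. N.awalk v p t \<and> length p = n)" for v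
  have depth_le: "depth v \<le> length p" if "N.awalk v p t" for v p
    unfolding depth_def by (rule Least_le) (use that in blast)
  have "\<exists>a. fst a \<in> T \<and> tail (traversals D) a = v
      \<and> depth (head (traversals D) a) < depth v" if v: "v \<in> verts D - {t}" for v
  proof -
    have "\<exists>n p. N.awalk v p t \<and> length p = n" using walk v by blast
    then have "\<exists>p. N.awalk v p t \<and> length p = depth v"
      unfolding depth_def by (rule LeastI_ex)
    then obtain p where p: "N.awalk v p t" "length p = depth v" by blast
    then obtain a q where "p = a # q" using v by (cases p) (auto simp: N.awalk_Nil_iff)
    then show ?thesis using p depth_le[of "head (traversals D) a" q]
      by (intro exI[of _ a]) (auto simp: N.awalk_Cons_iff)
  qed
  then obtain parent where parent: "\<And>v. v \<in> verts D - {t} \<Longrightarrow> fst (parent v) \<in> T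
      \<and> tail (traversals D) (parent v) = v \<and> depth (head (traversals D) (parent v)) < depth v"
    by metis
  interpret R: rooted_tree D t parent depth
    using parent T assms(3) by unfold_locales auto
  have sub: "R.tree_arcs \<subseteq> T" using parent by (auto simp: parent_arcs_def)
  moreover have "T \<subseteq> R.tree_arcs"
  proof (rule ccontr)
    assume "\<not> T \<subseteq> R.tree_arcs"
    then obtain e where e: "e \<in> T" "e \<notin> R.tree_arcs" by blast
    let ?u = "tail D e" and ?v = "head D e"
    interpret M: wf_digraph R.walks by (rule R.wf_walks)
    have uv: "?u \<in> verts D" "?v \<in> verts D" using e T by auto
    obtain p where p: "M.apath ?v p ?u"
      using connected_apath[OF R.wf_walks R.connected_parent_arcs] uv by auto
    have "distinct (map fst p)" by (rule apath_distinct_arcs[OF R.wf_walks p])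
    moreover have p': "M.awalk ?v p ?u" "distinct (M.awalk_verts ?v p)"
      using p by (auto simp: M.apath_def)
    moreover have "fst ` set p \<subseteq> R.tree_arcs" using p'(1) by (auto simp: M.awalk_def)
    moreover have "N.awalk_verts = M.awalk_verts"
      by (intro ext) (simp add: N.awalk_verts_conv M.awalk_verts_conv)
    moreover have cas: "M.cas x q y \<Longrightarrow> N.cas x q y" for x q y
      by (induction q arbitrary: x) auto
    moreover have "N.awalk ?v p ?u"
      using p'(1) sub cas[of ?v p ?u] by (auto simp: N.awalk_def M.awalk_def subset_iff)
    moreover have "tail (traversals D) (e, True) = ?u" "head (traversals D) (e, True) = ?v"
      by (simp_all add: traversals_def)
    ultimately have "undirected_cycle (span_subgraph D T) ((e, True) # p)"
      using e unfolding undirected_cycle_def N.cycle_def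
      by (auto simp: N.awalk_Cons_iff intro!: exI[of _ ?u])
    then show False using acyclic by blast
  qed
  ultimately show thesis using that R.rooted_tree_axioms by blast
qed

section \<open>Mixing two trees\<close>

text \<open>
  The sets \<open>P\<close> and \<open>Q\<close> XX \<open>t\<close> in the two
  trees.
\<close>

locale embracing_pair =
  fin_digraph D + A: rooted_tree D t parentA depthA + B: rooted_tree D t parentB depthB
  for D :: "('a,'b) pre_digraph" and t parentA depthA parentB depthB +
  fixes s :: 'a and P Q :: "'a set"
  assumes s_in_P: "s \<in> P" and P: "directed_ascent D t parentA P"
    and s_in_Q: "s \<in> Q" and Q: "directed_ascent D t parentB Q"
begin

definition mixed :: "'a set \<Rightarrow> 'a \<Rightarrow> 'b \<times> bool" where
  "mixed W v = (if v \<in> W then parentB v else parentA v)"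

abbreviation mixed_arcs :: "'a set \<Rightarrow> 'b set" where
  "mixed_arcs W \<equiv> parent_arcs D t (mixed W)"

definition parent_closed :: "'a set \<Rightarrow> bool" where
  "parent_closed W \<longleftrightarrow> t \<in> W \<and> W \<subseteq> verts D \<and> (\<forall>v\<in>W - {t}. B.up v \<in> W)"

lemma mixed_rooted_tree:
  assumes "parent_closed W" shows "\<exists>depth. rooted_tree D t (mixed W) depth"
proof -
  \<comment> \<open>Vertices outside \<open>W\<close> are placed deeper than all of \<open>W\<close>, so that crossing into \<open>W\<close> decreases the depth.\<close>
  let ?K = "Suc (Max (depthB ` verts D))"
  let ?depth = "\<lambda>v. if v \<in> W then depthB v else ?K + depthA v"
  have K: "depthB v < ?K" if "v \<in> verts D" for v
    using that by (simp add: less_Suc_eq_le)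
  have "?depth (head (traversals D) (mixed W v)) < ?depth v" if v: "v \<in> verts D - {t}" for v
  proof (cases "v \<in> W")
    case True
    then show ?thesis using assms v B.parent_depth[OF v] by (auto simp: parent_closed_def mixed_def)
  next
    case False
    then show ?thesis
      using A.parent_depth[OF v] K[of "A.up v"] A.up_in_verts[OF v] by (auto simp: mixed_def)
  qed
  then have "rooted_tree D t (mixed W) ?depth"
    using A.root A.parent_arc B.parent_arc A.parent_tail B.parent_tail
    by unfold_locales (auto simp: mixed_def)
  then show ?thesis by blast
qed

lemma mixed_embracing:
  assumes W: "parent_closed W" "W \<subseteq> Q \<or> Q \<subseteq> W"
  shows "embracing_spanning_tree D s t (mixed_arcs W)"
proof -
  obtain depth where "rooted_tree D t (mixed W) depth" using mixed_rooted_tree[OF W(1)] by blast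
  then interpret M: rooted_tree D t "mixed W" depth .
  have s: "s \<in> verts D" using s_in_P P by (auto simp: directed_ascent_def)
  have "\<exists>S. s \<in> S \<and> directed_ascent D t (mixed W) S"
    using W(2)
  proof
    assume "W \<subseteq> Q"
    \<comment> \<open>Climb along \<open>P\<close> until \<open>W\<close> is entered; from then on all parents are those of \<open>B\<close> and lie in \<open>W \<subseteq> Q\<close>.\<close>
    then have "directed_ascent D t (mixed W) (P \<union> W)"
      using P Q W(1) by (auto simp: directed_ascent_def mixed_def parent_closed_def)
    then show ?thesis using s_in_P by blast
  next
    assume "Q \<subseteq> W"
    then have "directed_ascent D t (mixed W) Q"
      using Q by (auto simp: directed_ascent_def mixed_def)
    then show ?thesis using s_in_Q by blast
  qed
  then show ?thesis using M.embracing_iff_directed_ascent[OF s] by blast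
qed

text \<open>
  A vertex of \<open>U - W\<close> of minimal depth in \<open>B\<close> has its parent in \<open>W\<close>.
\<close>

lemma parent_closed_extension:
  assumes "parent_closed W" "parent_closed U" "\<not> U \<subseteq> W"
  obtains y where "y \<in> U - W" "parent_closed (insert y W)"
proof -
  obtain y where y: "y \<in> U - W" "\<And>x. x \<in> U - W \<Longrightarrow> depthB y \<le> depthB x"
    using assms(3) ex_has_least_nat[of "\<lambda>y. y \<in> U - W" _ depthB] by blast
  have y': "y \<in> verts D - {t}" using y(1) assms(1,2) by (auto simp: parent_closed_def)
  have "B.up y \<in> U" using y(1) y' assms(2) by (auto simp: parent_closed_def)
  then have "B.up y \<in> W" using y(2)[of "B.up y"] B.parent_depth[OF y'] by force
  then have "parent_closed (insert y W)" using assms(1) y' by (auto simp: parent_closed_def)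
  with y(1) show thesis using that by blast
qed

text \<open>
  The two trees differ only in the parent arc of \<open>y\<close>. Injectivity of the parent arcs in each of them
  keeps the old and the new arc out of the common part \<open>X\<close>, so one arc is exchanged for another,
  and the new one belongs to \<open>B\<close>.
\<close>

lemma mixed_exchange:
  assumes W: "parent_closed W" "parent_closed (insert y W)" and y: "y \<notin> W"
    and neq: "mixed_arcs W \<noteq> mixed_arcs (insert y W)"
  shows "card (sym_diff (mixed_arcs W) (mixed_arcs (insert y W))) = 2"
    and "card (mixed_arcs (insert y W) \<inter> B.tree_arcs) \<ge> card (mixed_arcs W \<inter> B.tree_arcs)"
proof -
  obtain d d' where "rooted_tree D t (mixed W) d" "rooted_tree D t (mixed (insert y W)) d'"
    using mixed_rooted_tree W by blast
  then interpret M: rooted_tree D t "mixed W" d + M': rooted_tree D t "mixed (insert y W)" d' .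
  define X where "X = (\<lambda>v. fst (mixed W v)) ` (verts D - {t} - {y})"
  let ?a = "fst (parentA y)" and ?b = "fst (parentB y)"
  have yV: "y \<in> verts D - {t}" using W y by (auto simp: parent_closed_def)
  have X': "X = (\<lambda>v. fst (mixed (insert y W) v)) ` (verts D - {t} - {y})"
    unfolding X_def by (rule image_cong) (auto simp: mixed_def)
  have "mixed_arcs W = insert (fst (mixed W y)) X"
    unfolding parent_arcs_def X_def using yV by blast
  then have T: "mixed_arcs W = insert ?a X" by (simp add: mixed_def y)
  have "mixed_arcs (insert y W) = insert (fst (mixed (insert y W) y)) X"
    unfolding parent_arcs_def X' using yV by blast
  then have T': "mixed_arcs (insert y W) = insert ?b X" by (simp add: mixed_def)
  have a: "?a \<notin> X"
  proof
    assume "?a \<in> X"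
    then obtain v where "v \<in> verts D - {t} - {y}" "fst (mixed W y) = fst (mixed W v)"
      using y by (auto simp: X_def mixed_def)
    then show False using M.parent_inj[of y v] yV by blast
  qed
  have b: "?b \<notin> X"
  proof
    assume "?b \<in> X"
    then obtain v where "v \<in> verts D - {t} - {y}"
        "fst (mixed (insert y W) y) = fst (mixed (insert y W) v)"
      by (auto simp: X' mixed_def)
    then show False using M'.parent_inj[of y v] yV by blast
  qed
  have ab: "?a \<noteq> ?b" using neq T T' by auto
  have "sym_diff (mixed_arcs W) (mixed_arcs (insert y W)) = {?a, ?b}"
    using a b ab by (auto simp: T T')
  then show "card (sym_diff (mixed_arcs W) (mixed_arcs (insert y W))) = 2"
    using ab by simp
  have bB: "?b \<in> B.tree_arcs" using yV by (auto simp: parent_arcs_def)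
  have fin: "finite X" by (simp add: X_def)
  have "card (mixed_arcs W \<inter> B.tree_arcs) \<le> Suc (card (X \<inter> B.tree_arcs))"
    unfolding T by (simp add: Int_insert_left card_insert_if fin)
  also have "\<dots> = card (mixed_arcs (insert y W) \<inter> B.tree_arcs)"
    unfolding T' using b bB by (simp add: Int_insert_left fin)
  finally show "card (mixed_arcs (insert y W) \<inter> B.tree_arcs) \<ge> card (mixed_arcs W \<inter> B.tree_arcs)" .
qed

text \<open>
  The condition on \<open>W\<close> and \<open>Q\<close> is maintained by exhausting \<open>Q\<close> before any other vertex is
  added.
\<close>

lemma exchange_sequence:
  assumes "parent_closed W" "W \<subseteq> Q \<or> Q \<subseteq> W"
  shows "\<exists>(q::nat) (T :: nat \<Rightarrow> 'b set). q \<le> card (verts D - W)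
      \<and> T 0 = mixed_arcs W \<and> T q = B.tree_arcs
      \<and> (\<forall>i\<in>{0..q}. embracing_spanning_tree D s t (T i))
      \<and> (\<forall>i\<in>{1..q}. card (sym_diff (T (i - 1)) (T i)) = 2
            \<and> card (T i \<inter> B.tree_arcs) \<ge> card (T (i - 1) \<inter> B.tree_arcs))"
  using assms
proof (induction "card (verts D - W)" arbitrary: W rule: less_induct)
  case less
  have Q_closed: "parent_closed Q" using Q by (auto simp: parent_closed_def directed_ascent_def)
  have V_closed: "parent_closed (verts D)" using B.root B.up_in_verts by (auto simp: parent_closed_def)
  show ?case
  proof (cases "W = verts D")
    case True
    have "mixed_arcs W = B.tree_arcs"
      unfolding parent_arcs_def using True by (intro image_cong) (auto simp: mixed_def)
    then show ?thesis using mixed_embracing[OF less.prems]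
      by (intro exI[of _ 0] exI[of _ "\<lambda>_. mixed_arcs W"]) auto
  next
    case False
    have WV: "W \<subseteq> verts D" using less.prems(1) by (simp add: parent_closed_def)
    obtain y where y: "y \<in> verts D - W" "parent_closed (insert y W)" "insert y W \<subseteq> Q \<or> Q \<subseteq> insert y W"
    proof (cases "Q \<subseteq> W")
      case True
      have "\<not> verts D \<subseteq> W" using False WV by blast
      then obtain y where "y \<in> verts D - W" "parent_closed (insert y W)"
        using parent_closed_extension[OF less.prems(1) V_closed] by blast
      then show thesis using that True by blast
    next
      case False
      then obtain y where y: "y \<in> Q - W" "parent_closed (insert y W)"
        using parent_closed_extension[OF less.prems(1) Q_closed] by blast
      moreover have "Q \<subseteq> verts D" using Q_closed by (simp add: parent_closed_def)
      moreover have "W \<subseteq> Q" using False less.prems(2) by blast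
      ultimately show thesis by (intro that) blast+
    qed
    have card: "card (verts D - W) = Suc (card (verts D - insert y W))"
      using card_Suc_Diff1[of "verts D - W" y] y(1) unfolding Diff_insert[of "verts D" y W] by simp
    then have "card (verts D - insert y W) < card (verts D - W)" by simp
    from less.hyps[OF this y(2,3)] obtain q T where T: "q \<le> card (verts D - insert y W)"
        "T 0 = mixed_arcs (insert y W)" "T q = B.tree_arcs"
        "\<forall>i\<in>{0..q}. embracing_spanning_tree D s t (T i)"
        "\<forall>i\<in>{1..q}. card (sym_diff (T (i - 1)) (T i)) = 2
            \<and> card (T i \<inter> B.tree_arcs) \<ge> card (T (i - 1) \<inter> B.tree_arcs)"
      by blast
    show ?thesis
    proof (cases "mixed_arcs W = mixed_arcs (insert y W)")
      \<comment> \<open>Adding \<open>y\<close> does not change the tree, and the step is skipped.\<close>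
      case True
      then show ?thesis using T card by (intro exI[of _ q] exI[of _ T]) auto
    next
      case False
      define T' where "T' i = (case i of 0 \<Rightarrow> mixed_arcs W | Suc j \<Rightarrow> T j)" for i
      have y_notin: "y \<notin> W" using y(1) by simp
      have "embracing_spanning_tree D s t (T' i)" if "i \<le> Suc q" for i
        using that T(4) mixed_embracing[OF less.prems] by (cases i) (auto simp: T'_def)
      moreover have "card (sym_diff (T' (i - 1)) (T' i)) = 2
          \<and> card (T' i \<inter> B.tree_arcs) \<ge> card (T' (i - 1) \<inter> B.tree_arcs)" if i: "i \<in> {1..Suc q}" for i
      proof -
        obtain j where j: "i = Suc j" using i by (cases i) auto
        show ?thesis
        proof (cases j)
          case 0
          then show ?thesis
            using j mixed_exchange[OF less.prems(1) y(2) y_notin False] T(2) by (simp add: T'_def)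
        next
          case (Suc k)
          then show ?thesis using bspec[OF T(5), of j] i j by (simp add: T'_def)
        qed
      qed
      ultimately show ?thesis
        using T(1,3) card by (intro exI[of _ "Suc q"] exI[of _ T']) (auto simp: T'_def)
    qed
  qed
qed

end

theorem theorem3p1:
  fixes D :: "('a,'b) pre_digraph" and s t :: 'a and A B :: "'b set"
  assumes "fin_digraph D"
    and "s \<in> verts D" and "t \<in> verts D" and "s \<noteq> t"
    and "embracing_spanning_tree D s t A"
    and "embracing_spanning_tree D s t B"
  shows "\<exists>(q::nat) (T :: nat \<Rightarrow> 'b set).
           q \<le> card (verts D) - 1 \<and> T 0 = A \<and> T q = B \<and>
           (\<forall>i\<in>{0..q}. embracing_spanning_tree D s t (T i)) \<and>
           (\<forall>i\<in>{1..q}. card (sym_diff (T (i - 1)) (T i)) = 2 \<and>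
                         card (T i \<inter> B) \<ge> card (T (i - 1) \<inter> B))"
proof -
  interpret fin_digraph D by fact
  have trees: "undirected_spanning_tree D A" "undirected_spanning_tree D B"
    using assms(5,6) by (simp_all add: embracing_spanning_tree_def)
  obtain pA dA where A: "rooted_tree D t pA dA" "parent_arcs D t pA = A"
    by (rule spanning_tree_rooted[OF wf_digraph_axioms trees(1) assms(3)])
  obtain pB dB where B: "rooted_tree D t pB dB" "parent_arcs D t pB = B"
    by (rule spanning_tree_rooted[OF wf_digraph_axioms trees(2) assms(3)])
  interpret A: rooted_tree D t pA dA by (rule A(1))
  interpret B: rooted_tree D t pB dB by (rule B(1))
  obtain P where P': "s \<in> P" "directed_ascent D t pA P"
    using A.embracing_iff_directed_ascent[OF assms(2)] assms(5) A(2) by blast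
  obtain Q where Q': "s \<in> Q" "directed_ascent D t pB Q"
    using B.embracing_iff_directed_ascent[OF assms(2)] assms(6) B(2) by blast
  interpret embracing_pair D t pA dA pB dB s P Q
    using P' Q' by unfold_locales
  have "parent_closed {t}" "{t} \<subseteq> Q"
    using assms(3) Q'(2) by (auto simp: parent_closed_def directed_ascent_def)
  moreover have "mixed_arcs {t} = A"
    unfolding A(2)[symmetric] parent_arcs_def by (intro image_cong) (auto simp: mixed_def)
  moreover have "card (verts D - {t}) = card (verts D) - 1" using assms(3) by simp
  ultimately show ?thesis using exchange_sequence[of "{t}"] B(2) by simp
qed

end
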